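(* If $e \ge 5$ and $r \ge 3$ are integers, then there exists a numerical semigroup $S$ with embedding dimension $e$ and multiplicity $m = e + r$ such that $\eta(S) = \binom{e}{2} + 1$.
   Context: A numerical semigroup is a cofinite subset $S \subseteq \mathbb{Z}_{\ge 0}$ containing $0$ and closed under addition, with unique minimal generating set $n_1 < \cdots < n_e$; $e$ is the embedding dimension and $n_1$ the multiplicity. With $\varphi_S:\mathbb{Z}_{\ge 0}^e \to S$, $z \mapsto \sum z_in_i$, a presentation of $S$ is a subset of $\ker\varphi_S = \{(z,z') : \varphi_S(z) = \varphi_S(z')\}$ whose generated congruence is $\ker\varphi_S$; it is minimal if no proper subset is a presentation. All minimal presentations have the same cardinality, denoted $\eta(S)$. *)

theory Defs
  imports Complex_Main
begin

definition submonoid :: "nat set \<Rightarrow> bool" where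
  "submonoid S \<longleftrightarrow> 0 \<in> S \<and> (\<forall>a\<in>S. \<forall>b\<in>S. a + b \<in> S)"

definition numerical_semigroup :: "nat set \<Rightarrow> bool" where
  "numerical_semigroup S \<longleftrightarrow> submonoid S \<and> finite (- S)"

definition minimal_generating_set :: "nat set \<Rightarrow> nat set \<Rightarrow> bool" where
  "minimal_generating_set S A \<longleftrightarrow>
     submonoid hull A = S \<and> (\<forall>B. B \<subset> A \<longrightarrow> submonoid hull B \<noteq> S)"

lemma submonoid_hull: "submonoid (submonoid hull A)"
  by (rule hull_in) (auto simp: submonoid_def)

lemma ex1_minimal_generating_set:
  assumes S: "submonoid S"
  shows "\<exists>!A. minimal_generating_set S A"
proof -
  define A where "A = {a \<in> S. a \<noteq> 0 \<and> (\<forall>b\<in>S. \<forall>c\<in>S. a = b + c \<longrightarrow> b = 0 \<or> c = 0)}"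
  have "s \<in> submonoid hull A" if "s \<in> S" for s
    using that
  proof (induction s rule: less_induct)
    case (less s)
    have H: "submonoid (submonoid hull A)" by (rule submonoid_hull)
    show ?case
    proof (cases "s = 0 \<or> s \<in> A")
      case True
      then show ?thesis
        using H hull_subset[of A submonoid] unfolding submonoid_def by auto
    next
      case False
      with less.prems obtain b c where "b \<in> S" "c \<in> S" "s = b + c" "b \<noteq> 0" "c \<noteq> 0"
        unfolding A_def by blast
      then show ?thesis
        using less.IH[of b] less.IH[of c] H unfolding submonoid_def by auto
    qed
  qed
  moreover have "submonoid hull A \<subseteq> S"
    using S by (intro hull_minimal) (auto simp: A_def)
  ultimately have gen: "submonoid hull A = S" by blast
  have sub: "A \<subseteq> B" if B: "submonoid hull B = S" for B
  proof
    fix a assume a: "a \<in> A"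
    show "a \<in> B"
    proof (rule ccontr)
      assume "a \<notin> B"
      have sm: "submonoid (S - {a})"
        unfolding submonoid_def
      proof (intro conjI ballI)
        show "0 \<in> S - {a}" using S a by (auto simp: submonoid_def A_def)
      next
        fix x y assume xy: "x \<in> S - {a}" "y \<in> S - {a}"
        have "x + y \<noteq> a"
        proof
          assume eq: "x + y = a"
          then have "x = 0 \<or> y = 0" using a xy unfolding A_def by blast
          with eq xy show False by auto
        qed
        then show "x + y \<in> S - {a}" using xy S by (auto simp: submonoid_def)
      qed
      have "B \<subseteq> S - {a}"
        using \<open>a \<notin> B\<close> hull_subset[of B submonoid] B by auto
      then have "submonoid hull B \<subseteq> S - {a}" using sm by (rule hull_minimal)
      with B a show False by (auto simp: A_def)
    qed
  qed
  show ?thesis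
  proof (rule ex1I[of _ A])
    show "minimal_generating_set S A"
      unfolding minimal_generating_set_def using gen sub by blast
  next
    fix B assume "minimal_generating_set S B"
    then show "B = A"
      unfolding minimal_generating_set_def using gen sub[of B] by blast
  qed
qed

definition min_gens :: "nat set \<Rightarrow> nat set" where
  "min_gens S = (THE A. minimal_generating_set S A)"

definition embedding_dimension :: "nat set \<Rightarrow> nat" where
  "embedding_dimension S = card (min_gens S)"

definition multiplicity :: "nat set \<Rightarrow> nat" where
  "multiplicity S = Min (min_gens S)"

text \<open>The minimal generators in increasing order, indexed from 0: \<open>gen S i\<close> is $n_{i+1}$.\<close>

definition gen :: "nat set \<Rightarrow> nat \<Rightarrow> nat" where
  "gen S i = sorted_list_of_set (min_gens S) ! i"

text \<open>Elements of $\mathbb{Z}_{\ge 0}^e$ are functions vanishing outside \<open>{..<e}\<close>.\<close>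

definition vecs :: "nat \<Rightarrow> (nat \<Rightarrow> nat) set" where
  "vecs e = {z. \<forall>i\<ge>e. z i = 0}"

definition fact_hom :: "nat set \<Rightarrow> (nat \<Rightarrow> nat) \<Rightarrow> nat" where
  "fact_hom S z = (\<Sum>i<embedding_dimension S. z i * gen S i)"

definition fact_ker :: "nat set \<Rightarrow> ((nat \<Rightarrow> nat) \<times> (nat \<Rightarrow> nat)) set" where
  "fact_ker S = {(z, z'). z \<in> vecs (embedding_dimension S) \<and>
     z' \<in> vecs (embedding_dimension S) \<and> fact_hom S z = fact_hom S z'}"

definition monoid_congruence :: "nat \<Rightarrow> ((nat \<Rightarrow> nat) \<times> (nat \<Rightarrow> nat)) set \<Rightarrow> bool" where
  "monoid_congruence e C \<longleftrightarrow> equiv (vecs e) C \<and>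
     (\<forall>(z, z')\<in>C. \<forall>w\<in>vecs e. ((\<lambda>i. z i + w i), (\<lambda>i. z' i + w i)) \<in> C)"

definition presentation :: "nat set \<Rightarrow> ((nat \<Rightarrow> nat) \<times> (nat \<Rightarrow> nat)) set \<Rightarrow> bool" where
  "presentation S \<rho> \<longleftrightarrow> \<rho> \<subseteq> fact_ker S \<and>
     monoid_congruence (embedding_dimension S) hull \<rho> = fact_ker S"

definition minimal_presentation :: "nat set \<Rightarrow> ((nat \<Rightarrow> nat) \<times> (nat \<Rightarrow> nat)) set \<Rightarrow> bool" where
  "minimal_presentation S \<rho> \<longleftrightarrow> presentation S \<rho> \<and> (\<forall>\<sigma>. \<sigma> \<subset> \<rho> \<longrightarrow> \<not> presentation S \<sigma>)"

text \<open>All minimal presentations of a numerical semigroup are finite and have the same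
  cardinality; \<open>eta S\<close> is that common value, the unique element of the set of their cardinalities.\<close>

definition eta :: "nat set \<Rightarrow> nat" where
  "eta S = the_elem (card ` {\<rho>. minimal_presentation S \<rho>})"

end

theory Submission
  imports Defs
begin

text \<open>Put $m = e + r$ and let $S$ be generated by $m$, $x = 2m + 1$, $y = rm - 2$ and the
  numbers $w_k = 2rm - k$ for $k \in \{3, 5, 6, \dots, e\}$. The Ap\'ery set of $S$ with respect to
  $m$ consists of $ix$ ($i < r$), $y$, $x + y$, $2y$ and the $w_k$, and each of its elements has only
  one factorization. The minimal monomials in the generators other than $m$ whose value lies outside
  the Ap\'ery set are the quadratic monomials involving some $w_k$, together with $x^r$, $x^2y$,
  $xy^2$ and $y^3$. Each of them is an isolated vertex in the graph of factorizations of its value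
  (two factorizations being adjacent if they share a generator), while all other factorizations
  of the same value are connected to each other. A minimal presentation is therefore a spanning
  tree joining these monomials to the remaining factorizations, so $\eta(S)$ is their number,
  $\binom{e}{2} - 3 + 4$.\<close>

section \<open>Exponent vectors and their values\<close>

definition val :: "nat \<Rightarrow> (nat \<Rightarrow> nat) \<Rightarrow> (nat \<Rightarrow> nat) \<Rightarrow> nat" where
  "val e g z = (\<Sum>i<e. z i * g i)"

lemma val_add: "val e g (\<lambda>i. z i + w i) = val e g z + val e g w"
  by (simp add: val_def sum.distrib algebra_simps)

lemma val_diff: "M \<le> z \<Longrightarrow> val e g z = val e g M + val e g (\<lambda>i. z i - M i)"
  by (simp add: val_add[symmetric] le_fun_def)

lemma vecs_add: "z \<in> vecs e \<Longrightarrow> w \<in> vecs e \<Longrightarrow> (\<lambda>i. z i + w i) \<in> vecs e"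
  by (simp add: vecs_def)

lemma vecs_diff: "z \<in> vecs e \<Longrightarrow> (\<lambda>i. z i - w i) \<in> vecs e"
  by (simp add: vecs_def)

lemma vecs_upd: "z \<in> vecs e \<Longrightarrow> i < e \<Longrightarrow> z(i := c) \<in> vecs e"
  by (simp add: vecs_def)

lemma val_upd:
  assumes "i < e"
  shows "val e g (z(i := z i + c)) = val e g z + c * g i"
proof -
  have "val e g (z(i := z i + c)) = (\<Sum>j<e. z j * g j + (if j = i then c * g i else 0))"
    unfolding val_def by (intro sum.cong) (auto simp: algebra_simps)
  with assms show ?thesis by (simp add: sum.distrib val_def)
qed

lemma val_dec:
  assumes "i < e" "0 < z i"
  shows "val e g z = val e g (z(i := z i - 1)) + g i"
  using val_upd[OF assms(1), of g "z(i := z i - 1)" 1] assms(2) by simp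

definition unit :: "nat \<Rightarrow> nat \<Rightarrow> nat" where
  "unit i = (\<lambda>_. 0)(i := 1)"

lemma unit_vecs: "i < e \<Longrightarrow> unit i \<in> vecs e"
  by (simp add: unit_def vecs_def)

lemma val_zero: "val e g (\<lambda>_. 0) = 0"
  by (simp add: val_def)

lemma val_unit: "i < e \<Longrightarrow> val e g (unit i) = g i"
  using val_upd[of i e g "\<lambda>_. 0" 1] by (simp add: unit_def val_zero)

lemma member_le_val: "i < e \<Longrightarrow> z i * g i \<le> val e g z"
  unfolding val_def by (intro member_le_sum) auto

section \<open>Semigroups given by generators\<close>

lemma submonoid_sum:
  assumes "submonoid H" "\<And>i. i \<in> A \<Longrightarrow> f i \<in> H"
  shows "sum f A \<in> H"
  using assms by (induction A rule: infinite_finite_induct) (auto simp: submonoid_def)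

lemma submonoid_mult: "submonoid H \<Longrightarrow> a \<in> H \<Longrightarrow> n * a \<in> H" for n :: nat
  by (induction n) (auto simp: submonoid_def)

lemma submonoid_val_image: "submonoid (val e g ` vecs e)"
  unfolding submonoid_def
proof (intro conjI ballI)
  show "0 \<in> val e g ` vecs e"
    by (intro image_eqI[of _ _ "\<lambda>_. 0"]) (auto simp: val_zero vecs_def)
qed (auto simp: val_add[symmetric] vecs_add intro!: imageI)

lemma hull_generators: "submonoid hull (g ` {..<e}) = val e g ` vecs e"
proof
  have "g ` {..<e} \<subseteq> val e g ` vecs e"
    by (auto simp: unit_vecs val_unit[symmetric] intro!: imageI)
  then show "submonoid hull (g ` {..<e}) \<subseteq> val e g ` vecs e"
    by (intro hull_minimal submonoid_val_image)
next
  have "z i * g i \<in> submonoid hull (g ` {..<e})" if "i < e" for z i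
    using that by (intro submonoid_mult[OF submonoid_hull] hull_inc) simp
  then have "val e g z \<in> submonoid hull (g ` {..<e})" for z
    unfolding val_def by (intro submonoid_sum[OF submonoid_hull]) simp
  then show "val e g ` vecs e \<subseteq> submonoid hull (g ` {..<e})" by blast
qed

text \<open>A generator whose only factorization is the trivial one is not a sum of two other
  elements, so the semigroup without it is still a submonoid. A set of generators lacking
  \<open>g i\<close> would stay inside that submonoid.\<close>

lemma min_gens_val_image:
  assumes unique: "\<And>i z. i < e \<Longrightarrow> z \<in> vecs e \<Longrightarrow> val e g z = g i \<Longrightarrow> z = unit i"
  shows "min_gens (val e g ` vecs e) = g ` {..<e}"
proof -
  let ?S = "val e g ` vecs e"
  have "minimal_generating_set ?S (g ` {..<e})"
    unfolding minimal_generating_set_def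
  proof (intro conjI allI impI notI hull_generators)
    fix B assume B: "B \<subset> g ` {..<e}" "submonoid hull B = ?S"
    then obtain i where i: "i < e" "g i \<notin> B" by blast
    have "submonoid (?S - {g i})"
      unfolding submonoid_def
    proof (intro conjI ballI)
      have "(\<lambda>_. 0) \<in> vecs e" "(\<lambda>_. 0) \<noteq> unit i"
        by (auto simp: vecs_def unit_def dest: fun_cong[where x = i])
      then have "g i \<noteq> 0" using unique[OF i(1), of "\<lambda>_. 0"] by (auto simp: val_zero)
      then show "0 \<in> ?S - {g i}" using submonoid_val_image[of e g] by (auto simp: submonoid_def)
    next
      fix x y assume "x \<in> ?S - {g i}" "y \<in> ?S - {g i}"
      then obtain z z' where z: "z \<in> vecs e" "x = val e g z" "x \<noteq> g i"
        and z': "z' \<in> vecs e" "y = val e g z'" "y \<noteq> g i" by blast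
      have "x + y \<noteq> g i"
      proof
        assume "x + y = g i"
        then have "(\<lambda>j. z j + z' j) = unit i"
          using z z' i by (intro unique) (auto simp: vecs_add val_add)
        then have sum: "z j + z' j = (if j = i then 1 else 0)" for j
          by (metis fun_upd_apply unit_def)
        have "z = unit i \<or> z' = unit i"
        proof (cases "z i = 0")
          case True
          then have "z' j = unit i j" for j
            using sum[of j] by (cases "j = i") (auto simp: unit_def)
          then show ?thesis by blast
        next
          case False
          with sum[of i] have "z i = 1" by simp
          then have "z j = unit i j" for j
            using sum[of j] by (cases "j = i") (auto simp: unit_def)
          then show ?thesis by blast
        qed
        with z z' i show False by (auto simp: val_unit)
      qed
      moreover have "x + y \<in> ?S"
        using submonoid_val_image[of e g] z z' by (auto simp: submonoid_def)
      ultimately show "x + y \<in> ?S - {g i}" by simp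
    qed
    moreover have "B \<subseteq> ?S - {g i}"
      using B(1) i hull_subset[of "g ` {..<e}" submonoid] unfolding hull_generators by blast
    ultimately have "submonoid hull B \<subseteq> ?S - {g i}" by (intro hull_minimal)
    moreover have "g i \<in> ?S"
      using i by (auto simp: unit_vecs val_unit[symmetric] intro!: imageI)
    ultimately show False using B(2) by blast
  qed
  then show ?thesis
    unfolding min_gens_def
    by (intro the1_equality ex1_minimal_generating_set submonoid_val_image)
qed

lemma congruence_translate:
  assumes "monoid_congruence e C" "(z, z') \<in> C" "w \<in> vecs e"
  shows "((\<lambda>i. z i + w i), (\<lambda>i. z' i + w i)) \<in> C"
  using assms by (auto simp: monoid_congruence_def)

text \<open>The monomials \<open>N\<close> represent the Ap\'ery set of the semigroup generated by
  \<open>g 0, \<dots>, g (e - 1)\<close> with respect to \<open>g 0\<close>; \<open>K\<close> consists of the minimal monomials in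
  the remaining generators whose value is not in the Ap\'ery set.\<close>

locale apery_monomials =
  fixes e :: nat and g :: "nat \<Rightarrow> nat" and N K :: "(nat \<Rightarrow> nat) set"
  assumes e_pos: "0 < e"
    and g_pos: "i < e \<Longrightarrow> 0 < g i"
    and N_vecs: "N \<subseteq> vecs e"
    and N_zero: "n \<in> N \<Longrightarrow> n 0 = 0"
    and N_inj: "inj_on (\<lambda>n. val e g n mod g 0) N"
    and K_finite: "finite K"
    and K_vecs: "K \<subseteq> vecs e"
    and K_zero: "M \<in> K \<Longrightarrow> M 0 = 0"
    and K_reduce: "M \<in> K \<Longrightarrow> \<exists>R\<in>vecs e. 0 < R 0 \<and> val e g R = val e g M"
    and K_pred: "M \<in> K \<Longrightarrow> 0 < M i \<Longrightarrow> M(i := M i - 1) \<in> N"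
    and N_or_K: "z \<in> vecs e \<Longrightarrow> z 0 = 0 \<Longrightarrow> z \<notin> N \<Longrightarrow> \<exists>M\<in>K. M \<le> z"
begin

lemma val_pos:
  assumes "z \<in> vecs e" "z i \<noteq> 0"
  shows "0 < val e g z"
proof -
  have "i < e" using assms by (auto simp: vecs_def not_less[symmetric])
  then have "z i * g i \<le> val e g z" unfolding val_def by (intro member_le_sum) auto
  with assms g_pos[OF \<open>i < e\<close>] show ?thesis
    by (metis bot_nat_0.not_eq_extremum mult_is_0 le_zero_eq)
qed

lemma raise:
  assumes "z \<in> vecs e" "z 0 = 0" "z \<notin> N"
  shows "\<exists>z'\<in>vecs e. 0 < z' 0 \<and> val e g z' = val e g z"
proof -
  obtain M where M: "M \<in> K" "M \<le> z" using N_or_K assms by blast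
  obtain R where R: "R \<in> vecs e" "0 < R 0" "val e g R = val e g M" using K_reduce M by blast
  show ?thesis
    using R M assms
    by (intro bexI[of _ "\<lambda>i. R i + (z i - M i)"])
      (auto simp: val_add val_diff[OF M(2)] vecs_add vecs_diff)
qed

text \<open>Peel off copies of \<open>g 0\<close>, using \<open>raise\<close> whenever none is
  visible; the value drops each time. The clause on \<open>0 < t\<close> is what
  \<open>N_unique\<close> exploits.\<close>

lemma normal_form:
  assumes "z \<in> vecs e"
  shows "\<exists>t. \<exists>n\<in>N. val e g z = t * g 0 + val e g n \<and> (0 < z 0 \<longrightarrow> 0 < t)"
  using assms
proof (induction "val e g z" arbitrary: z rule: less_induct)
  case less
  \<comment> \<open>Stated for any factorization of the same value, so that it serves both
    \<open>z\<close> itself and the vector supplied by \<open>raise\<close>.\<close>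
  have pos: "\<exists>t. \<exists>n\<in>N. val e g z' = t * g 0 + val e g n \<and> 0 < t"
    if z': "z' \<in> vecs e" "0 < z' 0" "val e g z' = val e g z" for z'
  proof -
    have d: "val e g z' = val e g (z'(0 := z' 0 - 1)) + g 0"
      using e_pos z' by (intro val_dec) auto
    obtain t n where "n \<in> N" "val e g (z'(0 := z' 0 - 1)) = t * g 0 + val e g n"
      using less.hyps[of "z'(0 := z' 0 - 1)"] d z' g_pos[OF e_pos] vecs_upd[OF z'(1) e_pos]
      by auto
    with d show ?thesis by (intro exI[of _ "Suc t"] bexI[of _ n]) auto
  qed
  consider "0 < z 0" | "z \<in> N" | "z 0 = 0" "z \<notin> N" by blast
  then show ?case
  proof cases
    case 1
    with pos[of z] less.prems show ?thesis by blast
  next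
    case 2
    then show ?thesis using N_zero by (intro exI[of _ 0] bexI[of _ z]) auto
  next
    case 3
    with raise[OF less.prems] pos show ?thesis by fastforce
  qed
qed

text \<open>A factorization using \<open>g 0\<close> would give
  \<open>val e g n = t * g 0 + val e g n'\<close> with \<open>0 < t\<close>; equal residues force
  \<open>n = n'\<close>, which is absurd. Hence \<open>raise\<close> is never applicable,
  \<open>z\<close> lies in \<open>N\<close>, and residues separate \<open>N\<close>.\<close>

lemma N_unique:
  assumes n: "n \<in> N" and z: "z \<in> vecs e" "val e g z = val e g n"
  shows "z = n"
proof -
  have no: "z' 0 = 0" if z': "z' \<in> vecs e" "val e g z' = val e g n" for z'
  proof (rule ccontr)
    assume "z' 0 \<noteq> 0"
    then obtain t n' where t: "n' \<in> N" "val e g n = t * g 0 + val e g n'" "0 < t"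
      using normal_form[OF z'(1)] z'(2) by auto
    then have "n = n'" using inj_onD[OF N_inj, of n n'] n by simp
    with t g_pos[OF e_pos] show False by auto
  qed
  have "z \<in> N"
    using raise[OF z(1) no[OF z]] no z(2) by fastforce
  with inj_onD[OF N_inj, of z n] n z(2) show ?thesis by simp
qed

text \<open>Cancelling the shared generator turns \<open>M\<close> into an element of
  \<open>N\<close>, which has only one factorization.\<close>

lemma K_isolated:
  assumes M: "M \<in> K" and z: "z \<in> vecs e" "val e g z = val e g M" and i: "0 < M i" "0 < z i"
  shows "z = M"
proof -
  have "i < e" using z(1) i by (auto simp: vecs_def not_less[symmetric])
  with val_dec[of i e z g] val_dec[of i e M g] i z
  have "val e g (z(i := z i - 1)) = val e g (M(i := M i - 1))" by simp
  then have "z(i := z i - 1) = M(i := M i - 1)"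
    using N_unique[OF K_pred[OF M i(1)]] vecs_upd[OF z(1) \<open>i < e\<close>] by blast
  then have "(z(i := z i - 1)) j = (M(i := M i - 1)) j" for j by (simp only:)
  with i have "z j = M j" for j by (cases "j = i") (metis Suc_diff_1 fun_upd_same, metis fun_upd_other)
  then show ?thesis by auto
qed

section \<open>The kernel congruence and cuts of the graph on \<open>K\<close>\<close>

definition ker :: "((nat \<Rightarrow> nat) \<times> (nat \<Rightarrow> nat)) set" where
  "ker = {(z, z'). z \<in> vecs e \<and> z' \<in> vecs e \<and> val e g z = val e g z'}"

lemma congruence_ker: "monoid_congruence e ker"
  unfolding monoid_congruence_def
  by (auto simp: ker_def vecs_add val_add intro!: equivI refl_onI symI transI)

text \<open>Connectivity, phrased by cuts, of the graph with vertex set \<open>K\<close> plus one further vertex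
  standing for all monomials outside \<open>K\<close>, and with edge set \<open>\<sigma>\<close>.\<close>

definition connecting :: "((nat \<Rightarrow> nat) \<times> (nat \<Rightarrow> nat)) set \<Rightarrow> bool" where
  "connecting \<sigma> \<longleftrightarrow> (\<forall>U\<subseteq>K. U \<noteq> {} \<longrightarrow> (\<exists>z z'. (z, z') \<in> \<sigma> \<and> (z \<in> U) \<noteq> (z' \<in> U)))"

text \<open>The step of an induction on the value. Outside \<open>K\<close> and \<open>N\<close>,
  every factorization is related to one that uses \<open>g 0\<close>; two of those are related
  because cancelling \<open>g 0\<close> leads to a smaller value.\<close>

lemma outside_K_related:
  assumes C: "monoid_congruence e C"
    and IH: "\<And>u u'. (u, u') \<in> ker \<Longrightarrow> val e g u < val e g z \<Longrightarrow> (u, u') \<in> C"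
    and zz': "(z, z') \<in> ker" "z \<notin> K" "z' \<notin> K"
  shows "(z, z') \<in> C"
proof -
  have eq: "sym C" "trans C" "refl_on (vecs e) C"
    using C by (auto simp: monoid_congruence_def equiv_def)
  have up: "\<exists>w'\<in>vecs e. 0 < w' 0 \<and> (w, w') \<in> C \<and> val e g w' = val e g w"
    if w: "w \<in> vecs e" "w \<notin> K" "w \<notin> N" "val e g w = val e g z" for w
  proof (cases "w 0 = 0")
    case False
    moreover have "(w, w) \<in> C" using refl_onD[OF eq(3) w(1)] .
    ultimately show ?thesis using w(1) by auto
  next
    case True
    then obtain M where M: "M \<in> K" "M \<le> w" using N_or_K w by blast
    obtain R where R: "R \<in> vecs e" "0 < R 0" "val e g R = val e g M" using K_reduce M by blast
    let ?d = "\<lambda>i. w i - M i"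
    \<comment> \<open>As \<open>w\<close> is not in \<open>K\<close>, the divisor \<open>M\<close>
      is proper and has smaller value, so \<open>IH\<close> relates it to \<open>R\<close>;
      translating back by the cofactor \<open>?d\<close> relates \<open>w\<close> to a vector using
      \<open>g 0\<close>.\<close>
    from M w have "M \<noteq> w" by blast
    then obtain i where "M i \<noteq> w i" by blast
    with M(2) have "?d i \<noteq> 0" by (metis diff_is_0_eq le_fun_def le_antisym)
    then have "0 < val e g ?d" using val_pos[of ?d i] vecs_diff[OF w(1)] by blast
    then have "val e g M < val e g z" using val_diff[OF M(2)] w(4) by (metis less_add_same_cancel1)
    then have "(M, R) \<in> C" using IH[of M R] R M K_vecs by (auto simp: ker_def)
    then have "((\<lambda>i. M i + ?d i), (\<lambda>i. R i + ?d i)) \<in> C"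
      using congruence_translate[OF C] vecs_diff[OF w(1)] by blast
    moreover have "(\<lambda>i. M i + ?d i) = w" using M(2) by (auto simp: le_fun_def)
    ultimately show ?thesis using R w
      by (intro bexI[of _ "\<lambda>i. R i + ?d i"])
        (auto simp: vecs_add vecs_diff val_add val_diff[OF M(2)])
  qed
  show ?thesis
  proof (cases "z \<in> N \<or> z' \<in> N")
    case True
    then have "z = z'" using N_unique[of z z'] N_unique[of z' z] zz'(1) by (auto simp: ker_def)
    then show ?thesis using refl_onD[OF eq(3), of z] zz'(1) by (simp add: ker_def)
  next
    case False
    have vecs: "z \<in> vecs e" "z' \<in> vecs e" "val e g z' = val e g z"
      using zz'(1) by (auto simp: ker_def)
    obtain w where w: "w \<in> vecs e" "0 < w 0" "(z, w) \<in> C" "val e g w = val e g z"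
      using up[OF vecs(1) zz'(2)] False by blast
    obtain w' where w': "w' \<in> vecs e" "0 < w' 0" "(z', w') \<in> C" "val e g w' = val e g z"
      using up[OF vecs(2) zz'(3) _ vecs(3)] False vecs(3) by metis
    let ?u = "w(0 := w 0 - 1)" and ?u' = "w'(0 := w' 0 - 1)"
    have "val e g w = val e g ?u + g 0" "val e g w' = val e g ?u' + g 0"
      using val_dec[OF e_pos] w w' by auto
    with w w' g_pos[OF e_pos] have "(?u, ?u') \<in> C"
      by (intro IH) (auto simp: ker_def intro!: vecs_upd e_pos)
    moreover have "(\<lambda>i. of_bool (i = 0)) \<in> vecs e" using e_pos by (auto simp: vecs_def)
    ultimately have "((\<lambda>i. ?u i + of_bool (i = 0)), (\<lambda>i. ?u' i + of_bool (i = 0))) \<in> C"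
      by (rule congruence_translate[OF C])
    moreover have "(\<lambda>i. ?u i + of_bool (i = 0)) = w" "(\<lambda>i. ?u' i + of_bool (i = 0)) = w'"
      using w w' by auto
    ultimately have "(w, w') \<in> C" by simp
    with w w' eq show ?thesis by (meson symD transD)
  qed
qed

text \<open>Induction on the value: \<open>outside_K_related\<close> links all factorizations of
  this value outside \<open>K\<close>, and the cut condition excludes a nonempty set
  \<open>U\<close> of elements of \<open>K\<close> not linked to them.\<close>

lemma connecting_generates:
  assumes "connecting \<sigma>" "\<sigma> \<subseteq> ker" and C: "monoid_congruence e C" "\<sigma> \<subseteq> C"
  shows "(z, z') \<in> ker \<Longrightarrow> (z, z') \<in> C"
proof (induction "val e g z" arbitrary: z z' rule: less_induct)
  case less
  have eq: "sym C" "trans C"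
    using C by (auto simp: monoid_congruence_def equiv_def)
  have out: "(u, u') \<in> C" if "(u, u') \<in> ker" "u \<notin> K" "u' \<notin> K" "val e g u = val e g z" for u u'
    using outside_K_related[OF C(1) _ that(1-3)] less.hyps that(4) by metis
  \<comment> \<open>A base point outside \<open>K\<close>: if \<open>z\<close> itself is in
    \<open>K\<close>, a reduction \<open>R\<close> using \<open>g 0\<close> will do, since elements
    of \<open>K\<close> avoid \<open>g 0\<close>.\<close>
  have "\<exists>b. b \<in> vecs e \<and> b \<notin> K \<and> val e g b = val e g z"
  proof (cases "z \<in> K")
    case True
    then show ?thesis using K_reduce[of z] K_zero by (metis less_irrefl)
  next
    case False
    with less.prems show ?thesis by (auto simp: ker_def)
  qed
  then obtain b where b: "b \<in> vecs e" "b \<notin> K" "val e g b = val e g z" by blast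
  define U where "U = {M \<in> K. val e g M = val e g z \<and> (M, b) \<notin> C}"
  have U_iff: "u \<in> U \<longleftrightarrow> (u, b) \<notin> C" if "u \<in> vecs e" "val e g u = val e g z" for u
    using out[of u b] that b by (auto simp: U_def ker_def)
  have "U = {}"
  proof (rule ccontr)
    assume "U \<noteq> {}"
    then obtain u u' where u: "(u, u') \<in> \<sigma>" "(u \<in> U) \<noteq> (u' \<in> U)"
      using assms(1) unfolding connecting_def U_def by (metis (no_types, lifting) mem_Collect_eq subsetI)
    have "(u, u') \<in> ker" "(u, u') \<in> C" using u assms(2) C by auto
    then have k: "u \<in> vecs e" "u' \<in> vecs e" "val e g u = val e g u'" by (auto simp: ker_def)
    moreover have "val e g u = val e g z" using u(2) k by (auto simp: U_def)
    ultimately have "(u, b) \<in> C \<longleftrightarrow> (u', b) \<notin> C" using U_iff[of u] U_iff[of u'] u(2) by auto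
    with \<open>(u, u') \<in> C\<close> eq show False by (meson symD transD)
  qed
  then have "(z, b) \<in> C" "(z', b) \<in> C"
    using U_iff[of z] U_iff[of z'] less.prems by (auto simp: ker_def)
  with eq show ?case by (meson symD transD)
qed

text \<open>If no pair of \<open>\<sigma>\<close> crosses \<open>U\<close>, the kernel pairs not
  separated by \<open>U\<close> form a congruence \<open>D\<close> containing
  \<open>\<sigma>\<close>. It misses the pair of some \<open>M\<close> in \<open>U\<close> and a
  reduction of \<open>M\<close>.\<close>

lemma generates_connecting:
  assumes "\<sigma> \<subseteq> ker" "ker \<subseteq> monoid_congruence e hull \<sigma>"
  shows "connecting \<sigma>"
  unfolding connecting_def
proof (intro allI impI, rule ccontr)
  fix U assume U: "U \<subseteq> K" "U \<noteq> {}" and no: "\<not> (\<exists>z z'. (z, z') \<in> \<sigma> \<and> (z \<in> U) \<noteq> (z' \<in> U))"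
  define D where "D = {(z, z') \<in> ker. z \<in> U \<longleftrightarrow> z' \<in> U}"
  \<comment> \<open>Compatibility with translation is where isolation enters: for nonzero
    \<open>w\<close> both translates share a generator, so if one is in \<open>U\<close> they
    coincide.\<close>
  have *: "(\<lambda>i. z' i + w i) \<in> U"
    if "(z, z') \<in> D" "w \<in> vecs e" "(\<lambda>i. z i + w i) \<in> U" for z z' w
  proof (cases "\<forall>i. w i = 0")
    case True
    with that show ?thesis by (auto simp: D_def)
  next
    case False
    then obtain i where "0 < w i" by auto
    then have "(\<lambda>i. z' i + w i) = (\<lambda>i. z i + w i)"
      using that U by (intro K_isolated[of _ _ i]) (auto simp: D_def ker_def vecs_add val_add)
    with that show ?thesis by simp
  qed
  have flip: "(z', z) \<in> D" if "(z, z') \<in> D" for z z' using that by (auto simp: D_def ker_def)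
  have "equiv (vecs e) D"
    by (intro equivI refl_onI symI transI) (auto simp: D_def ker_def)
  moreover have "((\<lambda>i. z i + w i), (\<lambda>i. z' i + w i)) \<in> D"
    if "(z, z') \<in> D" "w \<in> vecs e" for z z' w
    using *[OF that] *[OF flip[OF that(1)] that(2)] that
    by (auto simp: D_def ker_def vecs_add val_add)
  ultimately have "monoid_congruence e D" by (auto simp: monoid_congruence_def)
  moreover have "\<sigma> \<subseteq> D" using no assms(1) by (auto simp: D_def)
  ultimately have "ker \<subseteq> D" using assms(2) hull_minimal by blast
  obtain M where M: "M \<in> U" using U by blast
  obtain R where "R \<in> vecs e" "0 < R 0" "val e g R = val e g M" using K_reduce M U by blast
  then have "(M, R) \<in> ker" "R \<notin> U" using M U K_vecs K_zero[of R] by (auto simp: ker_def)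
  with \<open>ker \<subseteq> D\<close> M show False by (auto simp: D_def)
qed

section \<open>Spanning trees and the size of minimal presentations\<close>

text \<open>A spanning tree, grown edge by edge: \<open>\<tau>\<close> connects the vertices in \<open>A\<close> and does not
  touch the others.\<close>

lemma partial_tree:
  assumes "connecting \<sigma>" "k \<le> card K"
  shows "\<exists>A \<tau>. A \<subseteq> K \<and> card A = k \<and> \<tau> \<subseteq> \<sigma> \<and> finite \<tau> \<and> card \<tau> = k \<and>
    (\<forall>(z, z')\<in>\<tau>. z \<notin> K - A \<and> z' \<notin> K - A) \<and>
    (\<forall>U\<subseteq>K. U \<inter> A \<noteq> {} \<longrightarrow> (\<exists>z z'. (z, z') \<in> \<tau> \<and> (z \<in> U) \<noteq> (z' \<in> U)))"
  using assms(2)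
proof (induction k)
  case 0
  show ?case by (intro exI[of _ "{}"]) auto
next
  case (Suc k)
  then obtain A \<tau> where A: "A \<subseteq> K" "card A = k" "\<tau> \<subseteq> \<sigma>" "finite \<tau>" "card \<tau> = k"
    and untouched: "\<forall>(z, z')\<in>\<tau>. z \<notin> K - A \<and> z' \<notin> K - A"
    and cut: "\<forall>U\<subseteq>K. U \<inter> A \<noteq> {} \<longrightarrow> (\<exists>z z'. (z, z') \<in> \<tau> \<and> (z \<in> U) \<noteq> (z' \<in> U))"
    by auto
  \<comment> \<open>The cut around the untouched vertices is crossed by an edge with exactly one end
    in \<open>K - A\<close>; that end is the new vertex.\<close>
  have "K - A \<noteq> {}" using A Suc.prems by auto
  then obtain z z' where z: "(z, z') \<in> \<sigma>" "(z \<in> K - A) \<noteq> (z' \<in> K - A)"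
    using assms(1) unfolding connecting_def by (meson Diff_subset)
  obtain M where M: "M \<in> K - A" "M = z \<or> M = z'" using z(2) by blast
  let ?A = "insert M A" and ?\<tau> = "insert (z, z') \<tau>"
  have new: "(z, z') \<notin> \<tau>" using untouched z(2) by blast
  have "finite A" using A(1) K_finite finite_subset by blast
  have "?A \<subseteq> K" "card ?A = Suc k" "?\<tau> \<subseteq> \<sigma>" "finite ?\<tau>" "card ?\<tau> = Suc k"
    using A M new z \<open>finite A\<close> by auto
  moreover have "\<forall>(w, w')\<in>?\<tau>. w \<notin> K - ?A \<and> w' \<notin> K - ?A"
    using untouched z(2) M by auto
  moreover have "\<forall>U\<subseteq>K. U \<inter> ?A \<noteq> {} \<longrightarrow> (\<exists>w w'. (w, w') \<in> ?\<tau> \<and> (w \<in> U) \<noteq> (w' \<in> U))"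
  proof (intro allI impI)
    fix U assume U: "U \<subseteq> K" "U \<inter> ?A \<noteq> {}"
    show "\<exists>w w'. (w, w') \<in> ?\<tau> \<and> (w \<in> U) \<noteq> (w' \<in> U)"
    proof (cases "U \<inter> A = {}")
      case False
      with cut U show ?thesis by blast
    next
      case True
      with U have "M \<in> U" by auto
      \<comment> \<open>The other end of the new edge is outside \<open>K - A\<close>, hence outside
        \<open>U\<close>, so the new edge crosses \<open>U\<close>.\<close>
      moreover have "U \<subseteq> K - A" using True U by blast
      ultimately have "(z \<in> U) \<noteq> (z' \<in> U)" using z(2) M by auto
      then show ?thesis by auto
    qed
  qed
  ultimately show ?case by (intro exI[of _ ?A] exI[of _ ?\<tau>] conjI)
qed

lemma spanning_tree:
  assumes "connecting \<sigma>"
  shows "\<exists>\<tau>\<subseteq>\<sigma>. finite \<tau> \<and> card \<tau> = card K \<and> connecting \<tau>"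
proof -
  obtain A \<tau> where A: "A \<subseteq> K" "card A = card K" "\<tau> \<subseteq> \<sigma>" "finite \<tau>" "card \<tau> = card K"
    and cut: "\<forall>U\<subseteq>K. U \<inter> A \<noteq> {} \<longrightarrow> (\<exists>z z'. (z, z') \<in> \<tau> \<and> (z \<in> U) \<noteq> (z' \<in> U))"
    using partial_tree[OF assms order_refl] by (elim exE conjE) (rule that; assumption)
  have "A = K" using A K_finite card_subset_eq by blast
  have "connecting \<tau>"
    unfolding connecting_def
  proof (intro allI impI)
    fix U assume "U \<subseteq> K" "U \<noteq> {}"
    then show "\<exists>z z'. (z, z') \<in> \<tau> \<and> (z \<in> U) \<noteq> (z' \<in> U)"
      using cut[rule_format, of U] \<open>A = K\<close> by blast
  qed
  with A show ?thesis by blast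
qed

text \<open>Presentations are exactly the connecting subsets of \<open>ker\<close>. Each contains a
  spanning tree with \<open>card K\<close> edges, so a minimal one is such a tree.\<close>

lemma eta_eq_card:
  assumes e: "embedding_dimension S = e" and g: "\<And>i. i < e \<Longrightarrow> gen S i = g i"
  shows "eta S = card K"
proof -
  have ker: "fact_ker S = ker"
    using e g by (simp add: fact_ker_def ker_def fact_hom_def val_def)
  have pres: "presentation S \<sigma> \<longleftrightarrow> \<sigma> \<subseteq> ker \<and> connecting \<sigma>" for \<sigma>
  proof
    assume "presentation S \<sigma>"
    then show "\<sigma> \<subseteq> ker \<and> connecting \<sigma>"
      using generates_connecting[of \<sigma>] by (simp add: presentation_def ker e)
  next
    assume \<sigma>: "\<sigma> \<subseteq> ker \<and> connecting \<sigma>"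
    have "monoid_congruence e hull \<sigma> \<subseteq> ker"
      using \<sigma> congruence_ker by (intro hull_minimal) auto
    moreover have "ker \<subseteq> monoid_congruence e hull \<sigma>"
      unfolding hull_def using connecting_generates[of \<sigma>] \<sigma> by auto
    ultimately show "presentation S \<sigma>" using \<sigma> by (simp add: presentation_def ker e)
  qed
  have min_card: "card \<rho> = card K" if "minimal_presentation S \<rho>" for \<rho>
  proof -
    have \<rho>: "\<rho> \<subseteq> ker" "connecting \<rho>" using that by (auto simp: minimal_presentation_def pres)
    obtain \<tau> where \<tau>: "\<tau> \<subseteq> \<rho>" "card \<tau> = card K" "connecting \<tau>" using spanning_tree \<rho> by blast
    with \<rho> have "presentation S \<tau>" by (auto simp: pres)
    with that \<tau> have "\<tau> = \<rho>" unfolding minimal_presentation_def by blast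
    with \<tau> show ?thesis by simp
  qed
  \<comment> \<open>Existence of a minimal presentation, without which \<open>the_elem\<close> would
    have no singleton to act on. A tree in \<open>ker\<close> is minimal, since a smaller
    presentation would again contain \<open>card K\<close> edges.\<close>
  have "connecting ker"
    using congruence_ker by (intro generates_connecting hull_subset) auto
  then obtain \<tau> where \<tau>: "\<tau> \<subseteq> ker" "finite \<tau>" "card \<tau> = card K" "connecting \<tau>"
    using spanning_tree by blast
  have "minimal_presentation S \<tau>"
    unfolding minimal_presentation_def
  proof (intro conjI allI impI notI)
    show "presentation S \<tau>" using \<tau> by (simp add: pres)
  next
    fix \<sigma> assume \<sigma>: "\<sigma> \<subset> \<tau>" "presentation S \<sigma>"
    then obtain \<upsilon> where "\<upsilon> \<subseteq> \<sigma>" "card \<upsilon> = card K" using spanning_tree[of \<sigma>] pres[of \<sigma>] by auto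
    with \<sigma>(1) \<tau> show False
      by (metis card_mono finite_subset leD psubset_card_mono psubset_imp_subset)
  qed
  with min_card have "card ` {\<rho>. minimal_presentation S \<rho>} = {card K}" by auto
  then show ?thesis by (simp add: eta_def)
qed

end

section \<open>The concrete family of generators and monomials\<close>

locale semigroup_family =
  fixes e r :: nat
  assumes e5: "5 \<le> e" and r3: "3 \<le> r"
begin

definition m :: nat where
  m_eq: "m = e + r"

text \<open>Names the only nonlinear term, so that values become linear expressions in
  \<open>P\<close> and \<open>m\<close>.\<close>

definition P :: nat where
  "P = r * m"

text \<open>In increasing order, \<open>G i\<close> for $3 \le i \le e - 2$ is $w_{e+3-i}$.\<close>

definition G :: "nat \<Rightarrow> nat" where
  "G i = (if i = 0 then m else if i = 1 then 2 * m + 1 else if i = 2 then P - 2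
     else if i = e - 1 then 2 * P - 3 else 2 * P + i - (e + 3))"

lemma P_eq: "r * m = P"
  by (simp add: P_def)

text \<open>Keeps the truncated subtractions in \<open>G\<close> exact and places
  \<open>2 * m + 1\<close> below \<open>P - 2\<close>.\<close>

lemma P_ge: "3 * m \<le> P"
  using r3 P_eq mult_le_mono1 by metis

lemma G_simps:
  "G 0 = m" "G (Suc 0) = 2 * m + 1" "G 2 = P - 2" "G (e - Suc 0) = 2 * P - 3"
  "3 \<le> i \<Longrightarrow> i < e - 1 \<Longrightarrow> G i = 2 * P + i - (e + 3)"
  using e5 by (auto simp: G_def)

lemma G_strict_mono: "strict_mono_on {..<e} G"
  using e5 r3 P_ge m_eq by (auto simp: strict_mono_on_def G_def)

text \<open>\<open>xy a b\<close> is the monomial $x^a y^b$.\<close>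

definition xy :: "nat \<Rightarrow> nat \<Rightarrow> nat \<Rightarrow> nat" where
  "xy a b = (\<lambda>_. 0)(1 := a, 2 := b)"

abbreviation V :: "(nat \<Rightarrow> nat) \<Rightarrow> nat" where
  "V \<equiv> val e G"

lemma xy_vecs: "xy a b \<in> vecs e"
  using e5 by (simp add: xy_def vecs_def)

lemma xy_at_0: "xy a b 0 = 0"
  by (simp add: xy_def)

lemma V_xy: "V (xy a b) = a * (2 * m + 1) + b * (P - 2)"
proof -
  have "V (xy a 0) = a * (2 * m + 1)"
    using val_upd[of 1 e G "\<lambda>_. 0" a] e5 by (simp add: xy_def val_zero G_simps fun_upd_idem)
  then show ?thesis
    using val_upd[of 2 e G "xy a 0" b] e5 by (simp add: xy_def G_simps)
qed

text \<open>There are \<open>r + 3 + (e - 3) = m\<close> monomials here, one for each residue modulo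
  \<open>m\<close>.\<close>

definition N :: "(nat \<Rightarrow> nat) set" where
  "N = (\<lambda>c. xy c 0) ` {..<r} \<union> {xy 0 1, xy 1 1, xy 0 2} \<union> unit ` {3..<e}"

definition quad :: "nat \<times> nat \<Rightarrow> nat \<Rightarrow> nat" where
  "quad = (\<lambda>(j, i) k. unit i k + unit j k)"

text \<open>The condition \<open>i \<le> j\<close> with \<open>3 \<le> j\<close> lists each
  quadratic monomial involving some $w_k$ exactly once.\<close>

definition K :: "(nat \<Rightarrow> nat) set" where
  "K = quad ` (SIGMA j:{3..<e}. {1..j}) \<union> {xy r 0, xy 2 1, xy 1 2, xy 0 3}"

text \<open>\<open>above s\<close> says that $s - m \in S$, i.e. $s$ is in $S$ but not in the Ap\'ery set.\<close>

definition above :: "nat \<Rightarrow> bool" where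
  "above s \<longleftrightarrow> (\<exists>R\<in>vecs e. 0 < R 0 \<and> V R = s)"

lemma aboveI:
  assumes "z \<in> vecs e" "s = V z + Suc q * m"
  shows "above s"
  unfolding above_def using assms val_upd[of 0 e G z "Suc q"] e5
  by (intro bexI[of _ "z(0 := z 0 + Suc q)"]) (auto simp: G_simps vecs_upd)

text \<open>The monomial \<open>xy c 0\<close> has value \<open>2 * c * m + c\<close>, which leaves
  \<open>q - 2 * c > 0\<close> copies of \<open>m\<close>.\<close>

lemma above_low:
  assumes "s = q * m + c" "2 * c < q"
  shows "above s"
proof -
  obtain q' where "q = 2 * c + Suc q'" using assms(2) less_iff_Suc_add by auto
  with assms(1) show ?thesis
    by (intro aboveI[OF xy_vecs[of c 0], of _ q']) (simp add: V_xy algebra_simps)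
qed

text \<open>The residues \<open>-k\<close> are represented by $xy$, $y$, $w_3$, $y^2$ and $w_k$ for
  \<open>k = 1, 2, 3, 4\<close> and \<open>5 \<le> k\<close>. Their values plus \<open>k\<close> are
  at most \<open>2 * r * m\<close>, so \<open>2 * r < q\<close> leaves a positive multiple of
  \<open>m\<close>.\<close>

lemma above_high:
  assumes "s + k = q * m" "0 < k" "k \<le> e" "2 * r < q"
  shows "above s"
proof -
  obtain q' where q': "q = 2 * r + Suc q'" using assms(4) less_iff_Suc_add by auto
  have qm: "q * m = 2 * P + Suc q' * m" unfolding q' P_eq[symmetric] by (simp add: algebra_simps)
  \<comment> \<open>Needed for \<open>k = 1\<close>: there the value is
    \<open>P + 2 * m - 1\<close>, and \<open>r' = r - 2\<close> counts the copies of
    \<open>m\<close> between \<open>P + 2 * m\<close> and \<open>2 * P\<close>.\<close>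
  obtain r' where r': "r = r' + 2" using r3 by (metis add.commute le_Suc_ex numeral_3_eq_3 numeral_2_eq_2 Suc_leD)
  have r'm: "r' * m + 2 * m = P" by (simp only: P_eq[symmetric] add_mult_distrib[symmetric] r'[symmetric])
  consider "k = 1" | "k = 2" | "k = 3" | "k = 4" | "5 \<le> k" using assms(2) by linarith
  then show ?thesis
  proof cases
    case 1
    then show ?thesis
      using assms(1) qm r'm P_ge m_eq e5
      by (intro aboveI[OF xy_vecs[of 1 1], of _ "r' + q'"]) (simp add: V_xy add_mult_distrib)
  next
    case 2
    then show ?thesis
      using assms(1) qm P_eq P_ge m_eq e5
      by (intro aboveI[OF xy_vecs[of 0 1], of _ "r + q'"]) (simp add: V_xy add_mult_distrib)
  next
    case 3
    then show ?thesis
      using assms(1) qm P_ge m_eq e5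
      by (intro aboveI[OF unit_vecs[of "e - 1"], of _ q']) (auto simp: val_unit G_simps)
  next
    case 4
    then show ?thesis
      using assms(1) qm P_ge m_eq e5
      by (intro aboveI[OF xy_vecs[of 0 2], of _ q']) (simp add: V_xy)
  next
    case 5
    then have "3 \<le> e + 3 - k" "e + 3 - k < e - 1" using assms(3) by auto
    then show ?thesis
      using assms(1,3) qm P_ge m_eq 5
      by (intro aboveI[OF unit_vecs[of "e + 3 - k"], of _ q']) (auto simp: val_unit G_simps)
  qed
qed

text \<open>For \<open>t \<le> e\<close> the residue is \<open>-t\<close>. For
  \<open>e < t \<le> m\<close> it is \<open>m - t < r\<close>, a power of $x$. Beyond
  \<open>m\<close> it wraps around to \<open>-(t - m)\<close> with \<open>t - m \<le> e\<close>. The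
  last two cases cost one copy of \<open>m\<close>, which \<open>3 * r\<close> can afford.\<close>

lemma above_far:
  assumes "s + t = 3 * P + q * m" "0 < t" "t \<le> 2 * e"
  shows "above s"
proof -
  have q: "s + t = (3 * r + q) * m" using assms(1) by (simp add: P_eq[symmetric] algebra_simps)
  consider "t \<le> e" | "e < t" "t \<le> m" | "m < t" by linarith
  then show ?thesis
  proof cases
    case 1
    with q assms r3 show ?thesis by (intro above_high[of _ t "3 * r + q"]) auto
  next
    case 2
    obtain q' where q': "3 * r + q = Suc q'" using r3 by (cases "3 * r + q") auto
    have "s = q' * m + (m - t)" using q 2 unfolding q' by simp
    then show ?thesis using q' 2 m_eq r3 by (intro above_low[of _ q' "m - t"]) auto
  next
    case 3
    obtain q' where q': "3 * r + q = Suc q'" using r3 by (cases "3 * r + q") auto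
    have "s + (t - m) = q' * m" using q 3 unfolding q' by simp
    then show ?thesis using q' 3 m_eq r3 assms(3) by (intro above_high[of _ "t - m" q']) auto
  qed
qed

lemma G_high:
  assumes "3 \<le> i" "i < e"
  obtains k where "G i + k = 2 * P" "3 \<le> k" "k \<le> e"
proof (cases "i = e - 1")
  case True
  then have "G i + 3 = 2 * P" using P_ge m_eq e5 by (simp add: G_simps)
  with that[of 3] e5 show thesis by simp
next
  case False
  then have "G i + (e + 3 - i) = 2 * P" using P_ge m_eq e5 assms by (simp add: G_simps)
  with that[of "e + 3 - i"] assms False show thesis by simp
qed

lemma above_K:
  assumes "M \<in> K"
  shows "above (V M)"
proof -
  consider j i where "M = quad (j, i)" "3 \<le> j" "j < e" "1 \<le> i" "i \<le> j"
    | "M = xy r 0" | "M = xy 2 1" | "M = xy 1 2" | "M = xy 0 3"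
    using assms unfolding K_def by auto
  then show ?thesis
  proof cases
    case 1
    have V: "V M = G i + G j" using 1 by (simp add: quad_def val_add val_unit)
    obtain k where k: "G j + k = 2 * P" "3 \<le> k" "k \<le> e" using G_high 1 by blast
    \<comment> \<open>For $w_k$ times $x$, $y$ or $w_{k'}$ the values are
      \<open>2 * P + 2 * m - (k - 1)\<close>, \<open>3 * P - (k + 2)\<close> and
      \<open>4 * P - (k + k')\<close>.\<close>
    consider "i = 1" | "i = 2" | "3 \<le> i" using 1 by linarith
    then show ?thesis
    proof cases
      case 1
      have "V M + (k - 1) = 2 * P + 2 * m" using V k by (simp add: 1 G_simps)
      then have "V M + (k - 1) = (2 * r + 2) * m" by (simp add: P_eq[symmetric] add_mult_distrib)
      then show ?thesis using k by (intro above_high[of _ "k - 1" "2 * r + 2"]) auto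
    next
      case 2
      have "V M + (k + 2) = 3 * P + 0 * m" using V k P_ge m_eq e5 by (simp add: 2 G_simps)
      then show ?thesis using k e5 by (intro above_far[of _ "k + 2" 0]) auto
    next
      case 3
      obtain k' where k': "G i + k' = 2 * P" "3 \<le> k'" "k' \<le> e" using G_high 3 1 by force
      have "V M + (k + k') = 3 * P + r * m" using V k k' P_eq by simp
      then show ?thesis using k k' by (intro above_far[of _ "k + k'" r]) auto
    qed
  next
    case 2
    \<comment> \<open>Since \<open>r = m - e\<close>, the value \<open>2 * r * m + r\<close> of
      $x^r$ has residue \<open>-e\<close>.\<close>
    have "V M + e = (2 * r + 1) * m" using 2 by (simp add: V_xy m_eq algebra_simps)
    then show ?thesis using e5 by (intro above_high[of _ e "2 * r + 1"]) auto
  next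
    case 3
    have "V M = P + 4 * m" using P_ge m_eq e5 by (simp add: 3 V_xy)
    then have "V M = (r + 4) * m + 0" by (simp add: P_eq add_mult_distrib)
    then show ?thesis by (intro above_low[of _ "r + 4" 0]) auto
  next
    case 4
    have "V M + 3 = 2 * P + 2 * m" using P_ge m_eq e5 by (simp add: 4 V_xy)
    then have "V M + 3 = (2 * r + 2) * m" by (simp add: P_eq[symmetric] add_mult_distrib)
    then show ?thesis using e5 by (intro above_high[of _ 3 "2 * r + 2"]) auto
  next
    case 5
    have "V M + 6 = 3 * P + 0 * m" using P_ge m_eq e5 by (simp add: 5 V_xy)
    then show ?thesis using e5 by (intro above_far[of _ 6 0]) auto
  qed
qed

lemma mod_back:
  assumes "s + k = q * m" "0 < k" "k \<le> m"
  shows "s mod m = m - k"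
proof -
  obtain q' where "q = Suc q'" using assms by (cases q) auto
  with assms have "s = m - k + q' * m" by simp
  then have "s mod m = (m - k) mod m" by (simp only: mod_mult_self1)
  with assms show ?thesis by simp
qed

text \<open>A left inverse on \<open>N\<close> of taking the value modulo \<open>m\<close>, so that
  injectivity needs no comparison of pairs. In the last branch \<open>c = m - k\<close> with
  \<open>5 \<le> k\<close>, and \<open>c + 3 - r = e + 3 - k\<close> is the index of $w_k$.\<close>

definition monomial_of_residue :: "nat \<Rightarrow> nat \<Rightarrow> nat" where
  "monomial_of_residue c = (if c < r then xy c 0 else if c = m - 1 then xy 1 1
     else if c = m - 2 then xy 0 1 else if c = m - 4 then xy 0 2
     else if c = m - 3 then unit (e - 1) else unit (c + 3 - r))"

lemma monomial_of_residue:
  assumes "n \<in> N"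
  shows "monomial_of_residue (V n mod m) = n"
proof -
  have P2: "2 * P = (2 * r) * m" by (simp add: P_eq[symmetric])
  have distinct: "\<not> m - 1 < r" "\<not> m - 2 < r" "\<not> m - 3 < r" "\<not> m - 4 < r"
    "m - 2 \<noteq> m - 1" "m - 4 \<noteq> m - 1" "m - 4 \<noteq> m - 2"
    "m - 3 \<noteq> m - 1" "m - 3 \<noteq> m - 2" "m - 3 \<noteq> m - 4"
    using m_eq e5 by auto
  consider c where "n = xy c 0" "c < r" | "n = xy 0 1" | "n = xy 1 1" | "n = xy 0 2"
    | i where "n = unit i" "3 \<le> i" "i < e"
    using assms unfolding N_def by auto
  then show ?thesis
  proof cases
    case 1
    have "V n = c + (2 * c) * m" by (simp add: 1 V_xy algebra_simps)
    then have "V n mod m = c" using 1 m_eq by simp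
    with 1 show ?thesis by (simp add: monomial_of_residue_def)
  next
    case 2
    have "V n + 2 = r * m" using 2 P_eq P_ge m_eq e5 by (simp add: V_xy)
    then have "V n mod m = m - 2" by (rule mod_back) (use e5 m_eq in auto)
    with 2 distinct show ?thesis by (simp only: monomial_of_residue_def if_False if_True refl)
  next
    case 3
    have "V n + 1 = (r + 2) * m" using P_eq P_ge m_eq e5 by (simp add: 3 V_xy)
    then have "V n mod m = m - 1" by (rule mod_back) (use e5 m_eq in auto)
    with 3 distinct show ?thesis by (simp only: monomial_of_residue_def if_False if_True refl)
  next
    case 4
    have "V n + 4 = (2 * r) * m" using 4 P2 P_ge m_eq e5 by (simp add: V_xy)
    then have "V n mod m = m - 4" by (rule mod_back) (use e5 m_eq in auto)
    with 4 distinct show ?thesis by (simp only: monomial_of_residue_def if_False if_True refl)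
  next
    case 5
    show ?thesis
    proof (cases "i = e - 1")
      case True
      have "V n + 3 = (2 * r) * m" using 5 True P2 P_ge m_eq e5 by (simp add: val_unit G_simps)
      then have "V n mod m = m - 3" by (rule mod_back) (use e5 m_eq in auto)
      with 5 True distinct show ?thesis by (simp only: monomial_of_residue_def if_False if_True refl)
    next
      case False
      have "V n + (e + 3 - i) = (2 * r) * m"
        using 5 False P2 P_ge m_eq e5 by (simp add: val_unit G_simps)
      then have "V n mod m = m - (e + 3 - i)" by (rule mod_back) (use 5 e5 m_eq r3 in auto)
      moreover have "m - (e + 3 - i) = r + i - 3" using 5 m_eq by simp
      moreover have "\<not> r + i - 3 < r" "r + i - 3 \<noteq> m - 1" "r + i - 3 \<noteq> m - 2"
        "r + i - 3 \<noteq> m - 4" "r + i - 3 \<noteq> m - 3" "r + i - 3 + 3 - r = i"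
        using 5 False m_eq by auto
      ultimately show ?thesis using 5 by (simp only: monomial_of_residue_def if_False)
    qed
  qed
qed

section \<open>Counting \<open>K\<close>\<close>

lemma quad_inj: "inj_on quad (SIGMA j:{3..<e}. {1..j})"
proof (rule inj_onI, clarsimp)
  fix j i j' i' assume le: "i \<le> j" "i' \<le> j'" and eq: "quad (j, i) = quad (j', i')"
  have at: "unit i k + unit j k = unit i' k + unit j' k" for k
    using fun_cong[OF eq, of k] by (simp add: quad_def)
  have "j = j'" using at[of j] at[of j'] le by (auto simp: unit_def split: if_splits)
  moreover have "i = i'" using at[of i] \<open>j = j'\<close> by (auto simp: unit_def split: if_splits)
  ultimately show "j = j' \<and> i = i'" by simp
qed

lemma xy_eq_iff: "xy a b = xy a' b' \<longleftrightarrow> a = a' \<and> b = b'"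
proof
  assume eq: "xy a b = xy a' b'"
  show "a = a' \<and> b = b'" using fun_cong[OF eq, of 1] fun_cong[OF eq, of 2] by (simp add: xy_def)
qed simp

text \<open>The sum of all \<open>j < n\<close> is the binomial coefficient; the omitted terms are
  \<open>0 + 1 + 2\<close>.\<close>

lemma sum_from_3: "3 \<le> n \<Longrightarrow> (\<Sum>j=3..<n. j) + 3 = n choose 2"
proof (induction n rule: dec_induct)
  case base
  show ?case by (simp add: choose_two)
next
  case (step n)
  then show ?case by (simp add: numeral_2_eq_2)
qed

lemma card_K: "card K = (e choose 2) + 1"
proof -
  let ?Q = "quad ` (SIGMA j:{3..<e}. {1..j})" and ?X = "{xy r 0, xy 2 1, xy 1 2, xy 0 3}"
  have "card ?Q = (\<Sum>j=3..<e. j)" using card_image[OF quad_inj] by simp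
  moreover have "card ?X = 4" using r3 by (auto simp: xy_eq_iff)
  moreover have "?Q \<inter> ?X = {}"
  proof -
    have "xy a b \<noteq> quad (j, i)" if "3 \<le> j" for i j a b
    proof
      assume "xy a b = quad (j, i)"
      from fun_cong[OF this, of j] that show False by (auto simp: quad_def unit_def xy_def)
    qed
    then show ?thesis by auto
  qed
  ultimately have "card K = (\<Sum>j=3..<e. j) + 4"
    unfolding K_def by (subst card_Un_disjoint) auto
  with sum_from_3[of e] e5 show ?thesis by simp
qed

section \<open>Divisibility between \<open>N\<close> and \<open>K\<close>\<close>

lemma unit_in_N:
  assumes "1 \<le> i" "i < e"
  shows "unit i \<in> N"
proof -
  have "unit 1 = xy 1 0" "unit 2 = xy 0 1" by (auto simp: unit_def xy_def)
  then have "unit 1 \<in> N" "unit 2 \<in> N" using r3 by (auto simp: N_def)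
  moreover have "i = 1 \<or> i = 2 \<or> i \<in> {3..<e}" using assms by auto
  ultimately show ?thesis by (auto simp: N_def)
qed

lemma xy_in_N: "xy a b \<in> N" if "b = 0 \<and> a < r \<or> b = 1 \<and> a \<le> 1 \<or> b = 2 \<and> a = 0"
  using that by (auto simp: N_def le_Suc_eq)

lemma K_pred:
  assumes "M \<in> K" "0 < M k"
  shows "M(k := M k - 1) \<in> N"
proof -
  consider j i where "M = quad (j, i)" "3 \<le> j" "j < e" "1 \<le> i" "i \<le> j"
    | a b where "M = xy a b" "(a, b) \<in> {(r, 0), (2, 1), (1, 2), (0, 3)}"
    using assms unfolding K_def by auto
  then show ?thesis
  proof cases
    case 1
    then have "k = i \<or> k = j" using assms(2) by (auto simp: quad_def unit_def split: if_splits)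
    then have "M(k := M k - 1) = unit j \<or> M(k := M k - 1) = unit i"
      using 1 by (auto simp: quad_def unit_def fun_eq_iff)
    with 1 unit_in_N[of i] unit_in_N[of j] show ?thesis by auto
  next
    case 2
    then have "k = 1 \<or> k = 2" using assms(2) by (auto simp: xy_def split: if_splits)
    moreover have "M(1 := M 1 - 1) = xy (a - 1) b" "M(2 := M 2 - 1) = xy a (b - 1)" "M 1 = a" "M 2 = b"
      using 2 by (auto simp: xy_def)
    ultimately have "0 < a \<and> M(k := M k - 1) = xy (a - 1) b \<or> 0 < b \<and> M(k := M k - 1) = xy a (b - 1)"
      using assms(2) by metis
    then show ?thesis
      using 2 r3 by (auto intro!: xy_in_N)
  qed
qed

lemma N_or_K:
  assumes z: "z \<in> vecs e" "z 0 = 0" "z \<notin> N"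
  shows "\<exists>M\<in>K. M \<le> z"
proof (cases "\<exists>j\<ge>3. 0 < z j")
  case True
  then obtain j where j: "3 \<le> j" "0 < z j" by blast
  then have "j < e" using z by (auto simp: vecs_def not_less[symmetric])
  \<comment> \<open>A lone $w_k$ would lie in \<open>N\<close>, so \<open>z\<close> contains a
    second factor: the same generator again or another one.\<close>
  have "z \<noteq> unit j" using unit_in_N[of j] z j \<open>j < e\<close> by auto
  then obtain i where i: "z i \<noteq> unit j i" by blast
  have *: "\<exists>M\<in>K. M \<le> z" if le: "quad (j', i') \<le> z" and "3 \<le> j'" "j' < e" "1 \<le> i'" "i' \<le> j'" for i' j'
    using that by (intro bexI[of _ "quad (j', i')"]) (auto simp: K_def)
  show ?thesis
  proof (cases "i = j")
    case True
    then have "quad (j, j) \<le> z" using i j by (auto simp: le_fun_def quad_def unit_def)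
    with * j \<open>j < e\<close> show ?thesis by simp
  next
    case False
    then have i': "0 < z i" using i by (auto simp: unit_def)
    then have "i < e" "1 \<le> i" using z by (auto simp: vecs_def not_less[symmetric] Suc_le_eq intro: gr0I)
    have "quad (j, i) \<le> z" "quad (i, j) \<le> z"
      using i' j False by (auto simp: le_fun_def quad_def unit_def)
    with * j \<open>j < e\<close> \<open>i < e\<close> \<open>1 \<le> i\<close> show ?thesis by (cases "i \<le> j") auto
  qed
next
  case False
  have z_eq: "z = xy (z 1) (z 2)"
  proof
    fix i :: nat
    consider "i = 0" | "i = 1" | "i = 2" | "3 \<le> i" by linarith
    then show "z i = xy (z 1) (z 2) i" using z False by cases (auto simp: xy_def)
  qed
  have "xy a b \<le> z" if "a \<le> z 1" "b \<le> z 2" for a b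
    using that by (auto simp: xy_def le_fun_def)
  \<comment> \<open>The staircase in the $x,y$ plane: its corners are the four extra monomials of
    \<open>K\<close>, and the points below it lie in \<open>N\<close>.\<close>
  moreover have "r \<le> z 1 \<or> 2 \<le> z 1 \<and> 1 \<le> z 2 \<or> 1 \<le> z 1 \<and> 2 \<le> z 2 \<or> 3 \<le> z 2"
  proof (rule ccontr)
    assume "\<not> ?thesis"
    then have "z 2 = 0 \<and> z 1 < r \<or> z 2 = 1 \<and> z 1 \<le> 1 \<or> z 2 = 2 \<and> z 1 = 0" by presburger
    then have "xy (z 1) (z 2) \<in> N" by (rule xy_in_N)
    with z z_eq show False by simp
  qed
  ultimately show ?thesis unfolding K_def by auto
qed

lemma G_pos: "i < e \<Longrightarrow> 0 < G i"
  using G_strict_mono[unfolded strict_mono_on_def, rule_format, of 0 i] e5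
  by (cases "i = 0") (auto simp: G_simps m_eq)

sublocale apery_monomials e G N K
proof
  show "inj_on (\<lambda>n. V n mod G 0) N"
    by (rule inj_on_inverseI[of _ monomial_of_residue]) (simp add: G_simps monomial_of_residue)
  show "finite K" by (simp add: K_def)
  show "\<exists>R\<in>vecs e. 0 < R 0 \<and> V R = V M" if "M \<in> K" for M
    using above_K[OF that] by (simp add: above_def)
  show "N \<subseteq> vecs e" by (auto simp: N_def xy_vecs unit_vecs)
  show "K \<subseteq> vecs e" by (auto simp: K_def quad_def xy_vecs unit_vecs vecs_add)
  show "n 0 = 0" if "n \<in> N" for n
    using that by (auto simp: N_def xy_at_0 unit_def)
  show "M 0 = 0" if "M \<in> K" for M
    using that by (auto simp: K_def quad_def xy_at_0 unit_def)
  show "0 < e" using e5 by simp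
  show "0 < G i" if "i < e" for i using that by (rule G_pos)
  show "M(k := M k - 1) \<in> N" if "M \<in> K" "0 < M k" for M k using that by (rule K_pred)
  show "\<exists>M\<in>K. M \<le> z" if "z \<in> vecs e" "z 0 = 0" "z \<notin> N" for z using that by (rule N_or_K)
qed

section \<open>The semigroup and its invariants\<close>

lemma generator_unique:
  assumes i: "i < e" and z: "z \<in> vecs e" "V z = G i"
  shows "z = unit i"
proof (cases "i = 0")
  case False
  with i z show ?thesis using N_unique[OF unit_in_N[of i] z(1)] by (simp add: val_unit)
next
  case True
  \<comment> \<open>The generator \<open>m\<close> is not represented in \<open>N\<close>, but being
    the smallest it leaves no room for any other generator.\<close>
  have z0: "z j = 0" if "0 < j" for j
  proof (cases "j < e")
    case True
    then have "G 0 < G j" using G_strict_mono that by (auto simp: strict_mono_on_def)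
    moreover have "z j * G j \<le> G 0" using member_le_val[OF True, of z G] z \<open>i = 0\<close> by simp
    ultimately show ?thesis by (cases "z j") auto
  next
    case False
    with z show ?thesis by (simp add: vecs_def)
  qed
  have "V ((\<lambda>_. 0)(0 := z 0)) = z 0 * G 0"
    using val_upd[of 0 e G "\<lambda>_. 0" "z 0"] i by (simp add: val_zero)
  moreover have "(\<lambda>_. 0)(0 := z 0) = z" using z0 by (auto simp: fun_eq_iff)
  ultimately have "z 0 = 1" using z True G_pos[of 0] i by auto
  with z0 True show ?thesis by (auto simp: fun_eq_iff unit_def)
qed

definition S :: "nat set" where
  "S = V ` vecs e"

lemma min_gens_S: "min_gens S = G ` {..<e}"
  unfolding S_def by (intro min_gens_val_image generator_unique)

lemma sorted_min_gens: "sorted_list_of_set (min_gens S) = map G [0..<e]"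
proof -
  have "sorted_wrt (<) (map G [0..<e])"
    using G_strict_mono by (auto simp: sorted_wrt_map sorted_wrt_iff_nth_less strict_mono_on_def)
  moreover have "set (map G [0..<e]) = min_gens S" by (auto simp: min_gens_S)
  moreover have "sorted_list_of_set (set xs) = xs" if "sorted_wrt (<) xs" for xs :: "nat list"
    using that by (intro sorted_list_of_set.idem_if_sorted_distinct) (auto simp: strict_sorted_iff)
  ultimately show ?thesis by fastforce
qed

lemma embedding_dimension_S: "embedding_dimension S = e"
  using strict_mono_on_imp_inj_on[OF G_strict_mono]
  by (simp add: embedding_dimension_def min_gens_S card_image)

lemma gen_S: "i < e \<Longrightarrow> gen S i = G i"
  by (simp add: gen_def sorted_min_gens)

lemma multiplicity_S: "multiplicity S = m"
proof -
  have "m \<le> G i" if "i < e" for i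
    using G_strict_mono[unfolded strict_mono_on_def, rule_format, of 0 i] that e5
    by (cases "i = 0") (auto simp: G_simps)
  moreover have "m = G 0" by (simp add: G_simps)
  ultimately show ?thesis
    unfolding multiplicity_def min_gens_S using e5 by (intro Min_eqI) auto
qed

lemma numerical_semigroup_S: "numerical_semigroup S"
proof -
  \<comment> \<open>The bound makes \<open>n div m\<close> at least \<open>2 * m\<close>, enough to
    pay the \<open>2 * c\<close> copies of \<open>m\<close> in the value of \<open>xy c 0\<close>,
    where \<open>c < m\<close> is the residue.\<close>
  have "n \<in> S" if n: "m * (2 * m) \<le> n" for n
  proof -
    define c where "c = n mod m"
    have "c < m" using m_eq e5 by (simp add: c_def)
    have "2 * m \<le> n div m" using n m_eq e5 by (simp add: less_eq_div_iff_mult_less_eq algebra_simps)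
    with \<open>c < m\<close> obtain q where q: "n div m = 2 * c + q" using le_Suc_ex[of "2 * c" "n div m"] by auto
    have "n = n div m * m + c" unfolding c_def by (rule div_mult_mod_eq[symmetric])
    also have "\<dots> = V ((xy c 0)(0 := xy c 0 0 + q))"
      using val_upd[of 0 e G "xy c 0" q] e5 by (simp add: q V_xy G_simps algebra_simps)
    finally show ?thesis
      unfolding S_def by (rule image_eqI[where x = "(xy c 0)(0 := xy c 0 0 + q)"]) (use e5 in \<open>auto intro!: vecs_upd xy_vecs\<close>)
  qed
  then have "- S \<subseteq> {..<m * (2 * m)}" by (auto simp: not_le[symmetric])
  then have "finite (- S)" using finite_subset by blast
  then show ?thesis
    using submonoid_val_image by (simp add: numerical_semigroup_def S_def)
qed

lemma eta_S: "eta S = (e choose 2) + 1"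
  using eta_eq_card[OF embedding_dimension_S gen_S] card_K by simp

end

theorem theorem5p5:
  fixes e r :: nat
  assumes "e \<ge> 5" and "r \<ge> 3"
  shows "\<exists>S. numerical_semigroup S \<and> embedding_dimension S = e \<and>
    multiplicity S = e + r \<and> eta S = (e choose 2) + 1"
proof -
  interpret semigroup_family e r
    using assms by unfold_locales
  show ?thesis
    using numerical_semigroup_S embedding_dimension_S multiplicity_S eta_S m_eq by (intro exI[of _ S]) simp
qed

end
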